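(* Assume that the penalty is $q_\lambda(t)=\lambda^2q(t/\lambda)$ for $t\ge0$ with $\lambda>0$, where $q:[0,\infty)\to[0,\infty)$ satisfies: (i) $q$ is non-decreasing on $[0,\infty)$ with $q(0)=0$; (ii) $q$ is differentiable almost everywhere on $(0,\infty)$, $0\le q'(t)\le1$ and $\lim_{t\downarrow0}q'(t)=1$; (iii) $q'(t_1)\le q'(t_2)$ for all $t_1\ge t_2\ge0$. Assume also that for some predetermined $\delta\in(0,1)$ and $\kappa>0$ there exist constants $\alpha_1>\alpha_0>0$ such that $$q'(\alpha_0)>0,\qquad\frac{\alpha_0}{\sqrt{1+\{q'(\alpha_0)/2\}^2}}>\frac1{\delta\kappa\gamma_p}\quad\text{and}\quad q'(\alpha_1)=0.$$ Let $r\ge\gamma_p^{1/2}\alpha_0c_1s^{1/2}\lambda$ and $l=\{2+\frac2{q'(\alpha_0)}\}(c_1^2+1)^{1/2}(s/\gamma_p)^{1/2}$, where $c_1>0$ is the constant determined by $$0.5\,q'(\alpha_0)(c_1^2+1)^{1/2}+1=\alpha_0\kappa\gamma_pc_1.$$ Assume the beta-min condition $\min_{j\in\mathcal S}|\beta_j^*|\ge(\alpha_0+\alpha_1)\lambda$. Then, conditioned on the event $$\{\|w_h^{\rm ora}\|_\infty\le0.5\,q'(\alpha_0)\lambda\}\cap\{\|\hat\beta^{\rm ora}-\beta^*\|_\Sigma\le r/2\}\cap\mathcal G_{\rm rsc}(r,l,\kappa)\cap\Big\{\|\hat\beta^{\rm ora}-\beta^*\|_\infty\le\Big[\alpha_0-\frac{\sqrt{1+\{q'(\alpha_0)/2\}^2}}{\delta\kappa\gamma_p}\Big]\lambda\Big\},$$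 the strong oracle property holds: $\hat\beta^{(\ell)}=\hat\beta^{\rm ora}$ provided $\ell\ge\lceil\log(s^{1/2}/\delta)/\log(1/\delta)\rceil$.
   Context: Model. Fix $\tau\in(0,1)$. $x=(x_1,\dots,x_p)^T$ is a random vector with $x_1\equiv1$, $y=x^T\beta^*+\varepsilon$ with $P(\varepsilon\le0\mid x)=\tau$; $(y_i,x_i)_{i=1}^n$ are i.i.d. copies. $\mathcal S=\{j:\beta_j^*\ne0\}$, $s=|\mathcal S|$. $\Sigma=E(xx^T)$ is positive definite with smallest eigenvalue $\gamma_p\in(0,1]$; $\|u\|_\Sigma=\|\Sigma^{1/2}u\|_2$. Smoothed loss. $\rho_\tau(u)=u\{\tau-1(u<0)\}$; $K:\mathbb{R}\to[0,\infty)$ is a symmetric kernel integrating to one, $h>0$, $K_h(u)=h^{-1}K(u/h)$, $\bar K(u)=\int_{-\infty}^uK$, $\ell_h(u)=\int\rho_\tau(v)K_h(v-u)\,dv$, $\hat Q_h(\beta)=\frac1n\sum_i\ell_h(y_i-x_i^T\beta)$, $\nabla\hat Q_h(\beta)=\frac1n\sum_i\{\bar K((x_i^T\beta-y_i)/h)-\tau\}x_i$. Penalty. For $\lambda>0$, $q_\lambda(t)=\lambda^2q(t/\lambda)$ for $t\ge0$, where $q:[0,\infty)\to[0,\infty)$ satisfies: (i) $q$ is non-decreasing with $q(0)=0$; (ii) $q$ is differentiable almost everywhere on $(0,\infty)$, $0\le q'(t)\le1$ and $\lim_{t\downarrow0}q'(t)=1$; (iii) $q'(t_1)\le q'(t_2)$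 for all $t_1\ge t_2\ge0$. Here $q'$ denotes a fixed non-increasing version of the derivative with $q'(0)=1$; $q_\lambda'(t)=\lambda q'(t/\lambda)$. Iterates. $\hat\beta^{(0)}=0$, and for $\ell\ge1$, $\hat\beta^{(\ell)}\in\arg\min_\beta\{\hat Q_h(\beta)+\sum_{j=1}^pq_\lambda'(|\hat\beta_j^{(\ell-1)}|)|\beta_j|\}$. Oracle. $\hat\beta^{\rm ora}=\arg\min_{\beta\in\mathbb{R}^p:\beta_{\mathcal S^c}=0}\hat Q_h(\beta)$ and $w_h^{\rm ora}=\nabla\hat Q_h(\hat\beta^{\rm ora})\in\mathbb{R}^p$. Event. $\mathcal G_{\rm rsc}(r,l,\kappa)$ is the event that $\langle\nabla\hat Q_h(\beta_1)-\nabla\hat Q_h(\beta_2),\beta_1-\beta_2\rangle\ge\kappa\|\beta_1-\beta_2\|_\Sigma^2$ for all $(\beta_1,\beta_2)$ such that $\|\beta_1-\beta_2\|_\Sigma\le r$, $\|\beta_1-\beta_2\|_1\le l\|\beta_1-\beta_2\|_\Sigma$, $\|\beta_2-\beta^*\|_\Sigma\le r/2$ and $\mathrm{supp}(\beta_2)\subseteq\mathcal S$.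
   Formalization: When s = 1 the formal theorem requires ℓ ≥ 2: the stated bound allows ℓ = 1, but the first iterate is the plain ℓ1-penalized estimator, which never equals the oracle on the event. The kernel is also assumed to have a finite first absolute moment, so that the smoothed loss is finite. *)

theory Defs
  imports "HOL-Probability.Probability"
begin

section \<open>Vectors and matrices\<close>

definition supp :: "real ^ 'p \<Rightarrow> 'p set" where
  "supp \<beta> = {j. \<beta> $ j \<noteq> 0}"

definition l1norm :: "real ^ 'p \<Rightarrow> real" where
  "l1norm u = (\<Sum>j\<in>UNIV. \<bar>u $ j\<bar>)"

definition positive_definite :: "real ^ 'p ^ 'p \<Rightarrow> bool" where
  "positive_definite A \<longleftrightarrow> transpose A = A \<and> (\<forall>v. v \<noteq> 0 \<longrightarrow> 0 < v \<bullet> (A *v v))"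

definition is_eigenvalue :: "real ^ 'p ^ 'p \<Rightarrow> real \<Rightarrow> bool" where
  "is_eigenvalue A c \<longleftrightarrow> (\<exists>v. v \<noteq> 0 \<and> A *v v = c *\<^sub>R v)"

definition is_smallest_eigenvalue :: "real ^ 'p ^ 'p \<Rightarrow> real \<Rightarrow> bool" where
  "is_smallest_eigenvalue A c \<longleftrightarrow> is_eigenvalue A c \<and> (\<forall>d. is_eigenvalue A d \<longrightarrow> c \<le> d)"

text \<open>\<open>R\<close> is the (unique) positive semidefinite square root of \<open>A\<close>.\<close>

definition is_psd_sqrt :: "real ^ 'p ^ 'p \<Rightarrow> real ^ 'p ^ 'p \<Rightarrow> bool" where
  "is_psd_sqrt R A \<longleftrightarrow> transpose R = R \<and> (\<forall>v. 0 \<le> v \<bullet> (R *v v)) \<and> R ** R = A"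

text \<open>The norm \<open>\<parallel>u\<parallel>\<^sub>\<Sigma> = \<parallel>\<Sigma>\<^sup>1\<^sup>/\<^sup>2 u\<parallel>\<^sub>2\<close>, where \<open>R\<close> stands for \<open>\<Sigma>\<^sup>1\<^sup>/\<^sup>2\<close>.\<close>

definition wnorm :: "real ^ 'p ^ 'p \<Rightarrow> real ^ 'p \<Rightarrow> real" where
  "wnorm R u = norm (R *v u)"

section \<open>The linear quantile regression model\<close>

definition second_moment :: "'w measure \<Rightarrow> ('w \<Rightarrow> real ^ 'p) \<Rightarrow> real ^ 'p ^ 'p" where
  "second_moment M x = (\<chi> i j. LINT \<omega>|M. x \<omega> $ i * x \<omega> $ j)"

text \<open>
  The coordinate \<open>j1\<close> carries the intercept. The condition \<open>P(\<epsilon> \<le> 0 | x) = \<tau>\<close> is stated through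
  the conditional expectation of the indicator of \<open>{\<epsilon> \<le> 0}\<close> given the sigma-algebra generated by
  \<open>x\<close>. The data \<open>(X i, Y i)\<close>, \<open>i < n\<close>, are independent copies of \<open>(x, y)\<close>.
\<close>

locale quantile_regression = prob_space M
  for M :: "'w measure" +
  fixes \<tau> :: real
    and x :: "'w \<Rightarrow> real ^ 'p" and y \<epsilon> :: "'w \<Rightarrow> real"
    and j1 :: 'p and \<beta>star :: "real ^ 'p"
    and n :: nat and X :: "nat \<Rightarrow> 'w \<Rightarrow> real ^ 'p" and Y :: "nat \<Rightarrow> 'w \<Rightarrow> real"
  assumes tau: "0 < \<tau>" "\<tau> < 1"
    and x_measurable: "x \<in> borel_measurable M"
    and eps_measurable: "\<epsilon> \<in> borel_measurable M"
    and intercept: "\<forall>\<omega>\<in>space M. x \<omega> $ j1 = 1"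
    and linear_model: "\<forall>\<omega>\<in>space M. y \<omega> = x \<omega> \<bullet> \<beta>star + \<epsilon> \<omega>"
    and conditional_quantile:
      "AE \<omega> in M. real_cond_exp M (vimage_algebra (space M) x borel)
                     (indicator {\<omega>\<in>space M. \<epsilon> \<omega> \<le> 0}) \<omega> = \<tau>"
    and second_moments: "\<forall>i j. integrable M (\<lambda>\<omega>. x \<omega> $ i * x \<omega> $ j)"
    and Sigma_pos_def: "positive_definite (second_moment M x)"
    and sample_size: "0 < n"
    and sample_indep: "indep_vars (\<lambda>_. borel) (\<lambda>i \<omega>. (X i \<omega>, Y i \<omega>)) {..<n}"
    and sample_ident:
      "\<forall>i<n. distr M borel (\<lambda>\<omega>. (X i \<omega>, Y i \<omega>)) = distr M borel (\<lambda>\<omega>. (x \<omega>, y \<omega>))"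

section \<open>Convolution-smoothed quantile loss\<close>

text \<open>
  Finiteness of the first absolute moment of the kernel says precisely that the convolution integral
  defining the smoothed loss below exists (and is finite).
\<close>

definition smoothing_kernel :: "(real \<Rightarrow> real) \<Rightarrow> bool" where
  "smoothing_kernel K \<longleftrightarrow>
     (\<forall>u. 0 \<le> K u) \<and> (\<forall>u. K (- u) = K u) \<and>
     has_bochner_integral lborel K 1 \<and> integrable lborel (\<lambda>u. \<bar>u\<bar> * K u)"

definition check_loss :: "real \<Rightarrow> real \<Rightarrow> real" where
  "check_loss \<tau> u = u * (\<tau> - (if u < 0 then 1 else 0))"

definition scaled_kernel :: "(real \<Rightarrow> real) \<Rightarrow> real \<Rightarrow> real \<Rightarrow> real" where
  "scaled_kernel K h u = K (u / h) / h"

definition kernel_cdf :: "(real \<Rightarrow> real) \<Rightarrow> real \<Rightarrow> real" where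
  "kernel_cdf K u = (LINT v:{..u}|lborel. K v)"

definition smoothed_loss :: "real \<Rightarrow> (real \<Rightarrow> real) \<Rightarrow> real \<Rightarrow> real \<Rightarrow> real" where
  "smoothed_loss \<tau> K h u = (LINT v|lborel. check_loss \<tau> v * scaled_kernel K h (v - u))"

definition Qhat ::
  "real \<Rightarrow> (real \<Rightarrow> real) \<Rightarrow> real \<Rightarrow> nat \<Rightarrow> (nat \<Rightarrow> 'w \<Rightarrow> real ^ 'p) \<Rightarrow> (nat \<Rightarrow> 'w \<Rightarrow> real) \<Rightarrow>
   'w \<Rightarrow> real ^ 'p \<Rightarrow> real" where
  "Qhat \<tau> K h n X Y \<omega> \<beta> =
     (\<Sum>i<n. smoothed_loss \<tau> K h (Y i \<omega> - X i \<omega> \<bullet> \<beta>)) / real n"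

definition grad_Qhat ::
  "real \<Rightarrow> (real \<Rightarrow> real) \<Rightarrow> real \<Rightarrow> nat \<Rightarrow> (nat \<Rightarrow> 'w \<Rightarrow> real ^ 'p) \<Rightarrow> (nat \<Rightarrow> 'w \<Rightarrow> real) \<Rightarrow>
   'w \<Rightarrow> real ^ 'p \<Rightarrow> real ^ 'p" where
  "grad_Qhat \<tau> K h n X Y \<omega> \<beta> =
     (1 / real n) *\<^sub>R (\<Sum>i<n. (kernel_cdf K ((X i \<omega> \<bullet> \<beta> - Y i \<omega>) / h) - \<tau>) *\<^sub>R X i \<omega>)"

text \<open>\<open>grad_Qhat\<close> is indeed the gradient of \<open>Qhat\<close>.\<close>

lemma check_loss_lipschitz:
  assumes "0 < \<tau>" "\<tau> < 1"
  shows "\<bar>check_loss \<tau> a - check_loss \<tau> b\<bar> \<le> \<bar>a - b\<bar>"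
proof -
  have *: "check_loss \<tau> u = \<tau> * u + max (- u) 0" for u
    by (auto simp: check_loss_def algebra_simps max_def)
  have aux: "\<bar>check_loss \<tau> a - check_loss \<tau> b\<bar> \<le> \<bar>a - b\<bar>" if "b \<le> a" for a b
  proof -
    have "0 \<le> \<tau> * (a - b)" "\<tau> * (a - b) \<le> 1 * (a - b)"
      using that assms by (simp, intro mult_right_mono) auto
    then have "0 \<le> \<tau> * a - \<tau> * b" "\<tau> * a - \<tau> * b \<le> a - b"
      by (auto simp: algebra_simps)
    then show ?thesis
      using that unfolding * by (auto simp: max_def abs_if split: if_splits)
  qed
  show ?thesis
    using aux[of b a] aux[of a b] by (cases "b \<le> a") (auto simp: abs_minus_commute)
qed

lemma check_loss_deriv:
  assumes "a \<noteq> 0"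
  shows "(check_loss \<tau> has_real_derivative (\<tau> - (if a < 0 then 1 else 0))) (at a)"
proof (cases "a < 0")
  case True
  have "((\<lambda>u. u * (\<tau> - 1)) has_real_derivative \<tau> - 1) (at a)"
    by (auto intro!: derivative_eq_intros)
  then have "(check_loss \<tau> has_real_derivative \<tau> - 1) (at a)"
    by (rule DERIV_cong_ev[THEN iffD1, rotated -1, OF _ refl _ refl])
       (use True eventually_nhds_in_open[of "{..<0::real}" a] in
         \<open>auto simp: check_loss_def elim!: eventually_mono\<close>)
  then show ?thesis using True by simp
next
  case False
  then have pos: "0 < a" using assms by simp
  have "((\<lambda>u. u * \<tau>) has_real_derivative \<tau>) (at a)"
    by (auto intro!: derivative_eq_intros)
  then have "(check_loss \<tau> has_real_derivative \<tau>) (at a)"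
    by (rule DERIV_cong_ev[THEN iffD1, rotated -1, OF _ refl _ refl])
       (use pos eventually_nhds_in_open[of "{0::real<..}" a] in
         \<open>auto simp: check_loss_def elim!: eventually_mono\<close>)
  then show ?thesis using pos by simp
qed

lemma check_loss_measurable [measurable]: "check_loss \<tau> \<in> borel_measurable borel"
  unfolding check_loss_def[abs_def] by measurable

lemma smoothed_loss_rescale:
  assumes "0 < h"
  shows "smoothed_loss \<tau> K h u = (LINT w|lborel. check_loss \<tau> (u + h * w) * K w)"
proof -
  have "smoothed_loss \<tau> K h u =
      \<bar>h\<bar> *\<^sub>R (LINT w|lborel. check_loss \<tau> (u + h * w) * scaled_kernel K h ((u + h * w) - u))"
    unfolding smoothed_loss_def by (rule lborel_integral_real_affine) (use assms in auto)
  also have "\<dots> = (LINT w|lborel. h * (check_loss \<tau> (u + h * w) * scaled_kernel K h ((u + h * w) - u)))"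
    using assms by simp
  also have "\<dots> = (LINT w|lborel. check_loss \<tau> (u + h * w) * K w)"
    using assms by (intro Bochner_Integration.integral_cong) (auto simp: scaled_kernel_def)
  finally show ?thesis .
qed

lemma smoothed_loss_deriv:
  assumes K: "smoothing_kernel K" and h: "0 < h" and \<tau>: "0 < \<tau>" "\<tau> < 1"
  shows "(smoothed_loss \<tau> K h has_real_derivative (\<tau> - kernel_cdf K (- u / h))) (at u)"
proof -
  have K0: "\<And>w. 0 \<le> K w" and Kint: "integrable lborel K" and K1: "integral\<^sup>L lborel K = 1"
    and Kabs: "integrable lborel (\<lambda>u. \<bar>u\<bar> * K u)"
    using K by (auto simp: smoothing_kernel_def has_bochner_integral_iff)
  have Kmeas [measurable]: "K \<in> borel_measurable borel"
    using borel_measurable_integrable[OF Kint] by simp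
  have int: "integrable lborel (\<lambda>w. check_loss \<tau> (t + h * w) * K w)" for t
  proof (rule Bochner_Integration.integrable_bound)
    show "integrable lborel (\<lambda>w. \<bar>t\<bar> * K w + h * (\<bar>w\<bar> * K w))"
      using Kint Kabs by auto
    have "\<bar>check_loss \<tau> (t + h * w)\<bar> * K w \<le> (\<bar>t\<bar> + h * \<bar>w\<bar>) * K w" for w
    proof (rule mult_right_mono[OF _ K0])
      have "\<bar>check_loss \<tau> (t + h * w)\<bar> \<le> \<bar>t + h * w\<bar>"
        using check_loss_lipschitz[OF \<tau>, of "t + h * w" 0] by (simp add: check_loss_def)
      also have "\<dots> \<le> \<bar>t\<bar> + h * \<bar>w\<bar>"
        using h abs_triangle_ineq[of t "h * w"] by (simp add: abs_mult)
      finally show "\<bar>check_loss \<tau> (t + h * w)\<bar> \<le> \<bar>t\<bar> + h * \<bar>w\<bar>" .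
    qed
    then show "AE w in lborel. norm (check_loss \<tau> (t + h * w) * K w)
                 \<le> norm (\<bar>t\<bar> * K w + h * (\<bar>w\<bar> * K w))"
      using K0 h by (auto simp: abs_mult algebra_simps intro!: AE_I2)
  qed measurable
  let ?F = "smoothed_loss \<tau> K h"
  let ?D = "\<lambda>w. (\<tau> - indicator {..- u / h} w) * K w"
  have intD: "integral\<^sup>L lborel ?D = \<tau> - kernel_cdf K (- u / h)"
  proof -
    have "integrable lborel (\<lambda>w. indicator {..- u / h} w * K w)"
      using integrable_mult_indicator[of "{..- u / h}" lborel K] Kint by simp
    then have "integral\<^sup>L lborel ?D =
        \<tau> * integral\<^sup>L lborel K - (LINT w|lborel. indicator {..- u / h} w * K w)"
      using Kint by (simp add: left_diff_distrib)
    then show ?thesis by (simp add: K1 kernel_cdf_def set_lebesgue_integral_def)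
  qed
  have "((\<lambda>t. (?F t - ?F u) / (t - u)) \<longlongrightarrow> \<tau> - kernel_cdf K (- u / h)) (at u)"
    unfolding tendsto_at_iff_sequentially comp_def
  proof (intro allI impI)
    fix T assume T: "\<forall>i. T i \<in> UNIV - {u}" and lim: "T \<longlonglongrightarrow> u"
    let ?s = "\<lambda>i w. (check_loss \<tau> (T i + h * w) - check_loss \<tau> (u + h * w)) / (T i - u) * K w"
    have eq: "(?F (T i) - ?F u) / (T i - u) = integral\<^sup>L lborel (?s i)" for i
    proof -
      have "integral\<^sup>L lborel (?s i) =
         (LINT w|lborel. (check_loss \<tau> (T i + h * w) * K w - check_loss \<tau> (u + h * w) * K w) / (T i - u))"
        by (intro Bochner_Integration.integral_cong) (auto simp: field_simps)
      also have "\<dots> = (?F (T i) - ?F u) / (T i - u)"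
        using int by (simp add: smoothed_loss_rescale[OF h])
      finally show ?thesis by (rule sym)
    qed
    have "(\<lambda>i. integral\<^sup>L lborel (?s i)) \<longlonglongrightarrow> integral\<^sup>L lborel ?D"
    proof (rule integral_dominated_convergence[where w = K])
      have "AE w in lborel. w \<noteq> - u / h" by (rule AE_lborel_singleton)
      then show "AE w in lborel. (\<lambda>i. ?s i w) \<longlonglongrightarrow> ?D w"
      proof eventually_elim
        case (elim w)
        let ?a = "u + h * w"
        have a: "?a \<noteq> 0" "?a < 0 \<longleftrightarrow> w \<le> - u / h"
          using elim h by (auto simp: field_simps)
        have d: "((\<lambda>z. (check_loss \<tau> z - check_loss \<tau> ?a) / (z - ?a)) \<longlongrightarrow>
                \<tau> - (if ?a < 0 then 1 else 0)) (at ?a)"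
          using check_loss_deriv[OF a(1)] by (simp add: has_field_derivative_iff)
        have "(\<lambda>i. (check_loss \<tau> (T i + h * w) - check_loss \<tau> ?a) / ((T i + h * w) - ?a))
                \<longlonglongrightarrow> \<tau> - (if ?a < 0 then 1 else 0)"
          using d[unfolded tendsto_at_iff_sequentially comp_def, rule_format,
              of "\<lambda>i. T i + h * w"] T tendsto_add[OF lim tendsto_const[of "h * w"]] by auto
        then show ?case
          using a(2) by (intro tendsto_mult tendsto_const) (auto simp: indicator_def)
      qed
      show "AE w in lborel. norm (?s i w) \<le> K w" for i
      proof (rule AE_I2)
        fix w
        have ne: "T i \<noteq> u" using T by auto
        have "\<bar>(check_loss \<tau> (T i + h * w) - check_loss \<tau> (u + h * w)) / (T i - u)\<bar> \<le> 1"
          using check_loss_lipschitz[OF \<tau>, of "T i + h * w" "u + h * w"] ne by (simp add: field_simps)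
        from mult_right_mono[OF this K0[of w]]
        show "norm (?s i w) \<le> K w" using K0[of w] by (simp only: real_norm_def abs_mult)
      qed
    qed (use Kint in \<open>auto\<close>)
    then show "(\<lambda>i. (?F (T i) - ?F u) / (T i - u)) \<longlonglongrightarrow> \<tau> - kernel_cdf K (- u / h)"
      by (simp only: eq intD)
  qed
  then show ?thesis by (simp add: has_field_derivative_iff)
qed

lemma GDERIV_Qhat:
  assumes K: "smoothing_kernel K" and h: "0 < h" and \<tau>: "0 < \<tau>" "\<tau> < 1"
  shows "GDERIV (Qhat \<tau> K h n X Y \<omega>) \<beta> :> grad_Qhat \<tau> K h n X Y \<omega> \<beta>"
proof -
  have D: "((\<lambda>\<beta>. smoothed_loss \<tau> K h (Y i \<omega> - X i \<omega> \<bullet> \<beta>)) has_derivative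
       (\<lambda>v. (kernel_cdf K ((X i \<omega> \<bullet> \<beta> - Y i \<omega>) / h) - \<tau>) * (X i \<omega> \<bullet> v))) (at \<beta>)" for i
  proof -
    have "((\<lambda>\<beta>. Y i \<omega> - X i \<omega> \<bullet> \<beta>) has_derivative (\<lambda>v. - (X i \<omega> \<bullet> v))) (at \<beta>)"
      by (auto intro!: derivative_eq_intros)
    from has_derivative_compose[OF this
        smoothed_loss_deriv[OF assms, unfolded has_field_derivative_def]]
    show ?thesis by (simp add: algebra_simps)
  qed
  have "(Qhat \<tau> K h n X Y \<omega> has_derivative
      (\<lambda>v. (\<Sum>i<n. (kernel_cdf K ((X i \<omega> \<bullet> \<beta> - Y i \<omega>) / h) - \<tau>) * (X i \<omega> \<bullet> v)) / real n)) (at \<beta>)"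
    unfolding Qhat_def[abs_def] divide_inverse
    by (intro has_derivative_mult_left has_derivative_sum D[unfolded divide_inverse])
  then show ?thesis
    unfolding gderiv_def grad_Qhat_def
    by (simp add: inner_sum_right inner_sum_left inner_commute divide_inverse mult.commute)
qed

section \<open>Concave penalty, iterates, and restricted strong convexity\<close>

text \<open>
  \<open>q'\<close> is a fixed non-increasing version of the derivative of \<open>q\<close>, with \<open>q' 0 = 1\<close>; both functions
  are only constrained on \<open>[0,\<infinity>)\<close>.
\<close>

definition concave_penalty :: "(real \<Rightarrow> real) \<Rightarrow> (real \<Rightarrow> real) \<Rightarrow> bool" where
  "concave_penalty q q' \<longleftrightarrow>
     (\<forall>t\<ge>0. 0 \<le> q t) \<and> mono_on {0..} q \<and> q 0 = 0 \<and>
     (AE t in lborel. 0 < t \<longrightarrow> (q has_real_derivative q' t) (at t)) \<and>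
     (\<forall>t\<ge>0. 0 \<le> q' t \<and> q' t \<le> 1) \<and> (q' \<longlongrightarrow> 1) (at_right 0) \<and> q' 0 = 1 \<and>
     (\<forall>t1 t2. 0 \<le> t2 \<and> t2 \<le> t1 \<longrightarrow> q' t1 \<le> q' t2)"

text \<open>
  The derivative of the scaled penalty \<open>\<lambda>\<^sup>2 q(t/\<lambda>)\<close>.
\<close>

definition scaled_penalty_deriv :: "(real \<Rightarrow> real) \<Rightarrow> real \<Rightarrow> real \<Rightarrow> real" where
  "scaled_penalty_deriv q' lam t = lam * q' (t / lam)"

definition reweighted_l1 :: "(real \<Rightarrow> real) \<Rightarrow> real \<Rightarrow> real ^ 'p \<Rightarrow> real ^ 'p \<Rightarrow> real" where
  "reweighted_l1 q' lam \<beta>0 \<beta> = (\<Sum>j\<in>UNIV. scaled_penalty_deriv q' lam \<bar>\<beta>0 $ j\<bar> * \<bar>\<beta> $ j\<bar>)"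

text \<open>
  Since \<open>q' 0 = 1\<close>, the first iterate is plainly \<open>\<ell>\<^sub>1\<close>-penalized with weight \<open>lam\<close> on every coordinate.
  Hence it differs from every oracle estimator that has a nonzero coordinate: there the empirical
  gradient vanishes, so the coordinatewise derivative of the penalized objective is \<open>\<plusminus> lam\<close>.
  A strong oracle property can hold at \<open>k = 1\<close> only if the oracle estimator is \<open>0\<close>.
\<close>

definition is_iterate_sequence ::
  "(real ^ 'p \<Rightarrow> real) \<Rightarrow> (real \<Rightarrow> real) \<Rightarrow> real \<Rightarrow> (nat \<Rightarrow> real ^ 'p) \<Rightarrow> bool" where
  "is_iterate_sequence Q q' lam b \<longleftrightarrow>
     b 0 = 0 \<and>
     (\<forall>k\<ge>1. is_arg_min (\<lambda>\<beta>. Q \<beta> + reweighted_l1 q' lam (b (k - 1)) \<beta>) (\<lambda>_. True) (b k))"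

definition is_oracle_estimator :: "(real ^ 'p \<Rightarrow> real) \<Rightarrow> 'p set \<Rightarrow> real ^ 'p \<Rightarrow> bool" where
  "is_oracle_estimator Q S b \<longleftrightarrow> is_arg_min Q (\<lambda>\<beta>. \<forall>j. j \<notin> S \<longrightarrow> \<beta> $ j = 0) b"

text \<open>\<open>g\<close> is the random gradient field of the empirical loss and \<open>R\<close> stands for \<open>\<Sigma>\<^sup>1\<^sup>/\<^sup>2\<close>.\<close>

definition rsc_event ::
  "'w measure \<Rightarrow> ('w \<Rightarrow> real ^ 'p \<Rightarrow> real ^ 'p) \<Rightarrow> real ^ 'p ^ 'p \<Rightarrow> real ^ 'p \<Rightarrow>
   real \<Rightarrow> real \<Rightarrow> real \<Rightarrow> 'w set" where
  "rsc_event M g R \<beta>star r l \<kappa> = {\<omega>\<in>space M.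
     \<forall>\<beta>1 \<beta>2. wnorm R (\<beta>1 - \<beta>2) \<le> r \<and> l1norm (\<beta>1 - \<beta>2) \<le> l * wnorm R (\<beta>1 - \<beta>2) \<and>
       wnorm R (\<beta>2 - \<beta>star) \<le> r / 2 \<and> supp \<beta>2 \<subseteq> supp \<beta>star \<longrightarrow>
       \<kappa> * (wnorm R (\<beta>1 - \<beta>2))\<^sup>2 \<le> (g \<omega> \<beta>1 - g \<omega> \<beta>2) \<bullet> (\<beta>1 - \<beta>2)}"

end

theory Submission
  imports Defs
begin

text \<open>
  Write \<open>D = \<beta> - bo\<close> for the error of a reweighted \<open>\<ell>\<^sub>1\<close> minimizer \<open>\<beta>\<close> with respect to the oracle
  estimator \<open>bo\<close>, \<open>a = q' \<alpha>0\<close>, and let \<open>E\<close> consist of \<open>S\<close> and the coordinates whose weight is below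
  \<open>a lam\<close>. The gradient vanishes at \<open>bo\<close> on \<open>S\<close> and is at most \<open>a lam / 2\<close> elsewhere, so comparing
  \<open>\<beta>\<close> with \<open>bo\<close> along the segment joining them bounds \<open>\<langle>g \<beta> - g bo, D\<rangle>\<close> by \<open>\<langle>v, \<bar>D\<bar>\<rangle>\<close> minus
  \<open>a lam / 2\<close> times the \<open>\<ell>\<^sub>1\<close> mass of \<open>D\<close> off \<open>E\<close>, where \<open>v\<close> is the weight on \<open>S\<close>, \<open>a lam / 2\<close> on
  \<open>E - S\<close> and \<open>0\<close> off \<open>E\<close>. Monotonicity of the gradient then puts \<open>D\<close> in a cone where restricted
  strong convexity applies, whence \<open>\<kappa> \<gamma> \<parallel>D\<parallel> \<le> \<parallel>v\<parallel>\<close>. A coordinate of \<open>v\<close> is nonzero only if the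
  previous iterate missed \<open>bo\<close> there by more than \<open>lam / (\<delta> \<kappa> \<gamma>)\<close>; hence \<open>\<parallel>v\<parallel>\<close> is at most
  \<open>\<delta> \<kappa> \<gamma>\<close> times the previous error. The errors decay geometrically, and once they are below
  \<open>lam / (\<delta> \<kappa> \<gamma>)\<close> the vector \<open>v\<close> is \<open>0\<close>.
\<close>

section \<open>The smallest eigenvalue of a symmetric matrix\<close>

lemma inner_matrix_vector_symmetric:
  fixes A :: "real ^ 'p ^ 'p"
  assumes "transpose A = A"
  shows "u \<bullet> (A *v v) = (A *v u) \<bullet> v"
  using assms by (metis dot_lmul_matrix transpose_matrix_vector)

text \<open>For small \<open>t\<close> of sign opposite to \<open>b\<close> the linear term would
  dominate and make the expression negative.\<close>

lemma quadratic_nonneg_imp_linear_zero: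
  fixes b c :: real
  assumes "\<And>t. 0 \<le> 2 * t * b + t\<^sup>2 * c"
  shows "b = 0"
proof (rule ccontr)
  assume "b \<noteq> 0"
  \<comment> \<open>\<open>d\<close> bounds \<open>c\<close> and stays positive even when
    \<open>c\<close> is not; the \<open>t\<close> chosen below minimizes the quadratic with
    \<open>d\<close> in place of \<open>c\<close>.\<close>
  define d where "d = \<bar>c\<bar> + 1"
  have d: "0 < d" "c \<le> d" by (auto simp: d_def)
  define t where "t = - b / d"
  have "2 * t * b + t\<^sup>2 * c \<le> 2 * t * b + t\<^sup>2 * d"
    using d by (intro add_left_mono mult_left_mono) auto
  also have "\<dots> = - (b\<^sup>2 / d)"
    using d by (simp add: t_def field_simps power2_eq_square)
  also have "\<dots> < 0"
    using \<open>b \<noteq> 0\<close> d by (simp add: divide_pos_pos)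
  finally show False using assms[of t] by simp
qed

text \<open>The minimum of the quadratic form on the unit sphere exists by compactness and is itself
  an eigenvalue, so \<open>c\<close> cannot exceed it.\<close>

lemma rayleigh_smallest_eigenvalue:
  fixes A :: "real ^ 'p ^ 'p"
  assumes sym: "transpose A = A" and c: "is_smallest_eigenvalue A c"
  shows "c * (norm v)\<^sup>2 \<le> v \<bullet> (A *v v)"
proof -
  let ?f = "\<lambda>v::real ^ 'p. v \<bullet> (A *v v)"
  have "axis undefined 1 \<in> sphere (0::real ^ 'p) 1" by simp
  then have "sphere (0::real ^ 'p) 1 \<noteq> {}" by blast
  moreover have "continuous_on (sphere 0 1) ?f"
    by (intro continuous_intros linear_continuous_on bounded_linear_intros)
       (simp add: linear_linear matrix_vector_mul_bounded_linear)
  ultimately obtain v0 where v0: "norm v0 = 1" and min: "\<And>v. norm v = 1 \<Longrightarrow> ?f v0 \<le> ?f v"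
    using continuous_attains_inf[of "sphere (0::real ^ 'p) 1" ?f] by auto
  define \<mu> where "\<mu> = ?f v0"
  have ray: "\<mu> * (norm v)\<^sup>2 \<le> ?f v" for v
  proof (cases "v = 0")
    case False
    have "\<mu> \<le> ?f (v /\<^sub>R norm v)" using False unfolding \<mu>_def by (intro min) simp
    also have "\<dots> = ?f v / (norm v)\<^sup>2"
      by (simp add: matrix_vector_mult_scaleR power2_eq_square field_simps)
    finally show ?thesis using False by (simp add: field_simps)
  qed simp
  \<comment> \<open>\<open>?f v - \<mu> * (norm v)\<^sup>2\<close> is nonnegative and vanishes at
    \<open>v0\<close>, so its linear part at \<open>v0\<close> is zero in every direction
    \<open>u\<close>.\<close>
  have "u \<bullet> (A *v v0 - \<mu> *\<^sub>R v0) = 0" for u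
  proof (rule quadratic_nonneg_imp_linear_zero)
    fix t
    have "?f (v0 + t *\<^sub>R u) - \<mu> * (norm (v0 + t *\<^sub>R u))\<^sup>2 =
        2 * t * (u \<bullet> (A *v v0 - \<mu> *\<^sub>R v0)) + t\<^sup>2 * (?f u - \<mu> * (u \<bullet> u))"
      using v0 inner_matrix_vector_symmetric[OF sym, of v0 u] unfolding power2_norm_eq_inner
      by (simp add: \<mu>_def matrix_vector_right_distrib matrix_vector_mult_scaleR
            inner_simps inner_commute norm_eq_1 power2_eq_square algebra_simps)
    with ray[of "v0 + t *\<^sub>R u"]
    show "0 \<le> 2 * t * (u \<bullet> (A *v v0 - \<mu> *\<^sub>R v0)) + t\<^sup>2 * (?f u - \<mu> * (u \<bullet> u))"
      by simp
  qed
  then have "A *v v0 - \<mu> *\<^sub>R v0 = 0" using inner_eq_zero_iff by blast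
  then have "is_eigenvalue A \<mu>"
    using v0 unfolding is_eigenvalue_def by (intro exI[of _ v0]) auto
  then have "c \<le> \<mu>" using c by (simp add: is_smallest_eigenvalue_def)
  then have "c * (norm v)\<^sup>2 \<le> \<mu> * (norm v)\<^sup>2" by (rule mult_right_mono) simp
  with ray[of v] show ?thesis by linarith
qed

text \<open>Since \<open>R\<close> is symmetric with square \<open>A\<close>, the squared weighted
  norm is the quadratic form of \<open>A\<close>, to which the Rayleigh bound applies.\<close>

lemma wnorm_ge:
  assumes R: "is_psd_sqrt R A" and c: "is_smallest_eigenvalue A c" "0 \<le> c"
  shows "sqrt c * norm v \<le> wnorm R v"
proof -
  have symR: "transpose R = R" and RR: "R ** R = A" using R by (auto simp: is_psd_sqrt_def)
  then have "transpose A = A" by (metis matrix_transpose_mul)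
  from rayleigh_smallest_eigenvalue[OF this c(1), of v]
  have "c * (norm v)\<^sup>2 \<le> v \<bullet> (R *v (R *v v))"
    by (simp add: RR[symmetric] matrix_vector_mul_assoc)
  also have "\<dots> = (wnorm R v)\<^sup>2"
    by (simp add: inner_matrix_vector_symmetric[OF symR] wnorm_def power2_norm_eq_inner)
  finally have "(sqrt c * norm v)\<^sup>2 \<le> (wnorm R v)\<^sup>2" using c by (simp add: power_mult_distrib)
  then show ?thesis by (rule power2_le_imp_le) (simp add: wnorm_def)
qed

lemma wnorm_scaleR: "wnorm R (c *\<^sub>R v) = \<bar>c\<bar> * wnorm R v"
  by (simp add: wnorm_def matrix_vector_mult_scaleR)

section \<open>Convexity and first-order conditions\<close>

lemma kernel_cdf_mono:
  assumes "smoothing_kernel K"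
  shows "mono (kernel_cdf K)"
proof (rule monoI)
  fix u v :: real assume "u \<le> v"
  have K: "\<And>u. 0 \<le> K u" "integrable lborel K"
    using assms by (auto simp: smoothing_kernel_def has_bochner_integral_iff)
  have "integrable lborel (\<lambda>w. indicator {..t} w *\<^sub>R K w)" for t
    using K(2) by (intro integrable_mult_indicator) auto
  then show "kernel_cdf K u \<le> kernel_cdf K v"
    unfolding kernel_cdf_def set_lebesgue_integral_def
    using K(1) \<open>u \<le> v\<close> by (intro integral_mono) (auto simp: indicator_def)
qed

text \<open>Each summand is a non-decreasing function of
  \<open>X i \<omega> \<bullet> \<beta>\<close> times \<open>X i \<omega>\<close>. This is how
  convexity of the loss enters the later argument.\<close>

lemma grad_Qhat_monotone:
  assumes "smoothing_kernel K" "0 < h"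
  shows "0 \<le> (grad_Qhat \<tau> K h n X Y \<omega> \<beta>1 - grad_Qhat \<tau> K h n X Y \<omega> \<beta>2) \<bullet> (\<beta>1 - \<beta>2)"
proof -
  let ?F = "\<lambda>i \<beta>. kernel_cdf K ((X i \<omega> \<bullet> \<beta> - Y i \<omega>) / h)"
  have "0 \<le> (?F i \<beta>1 - ?F i \<beta>2) * (X i \<omega> \<bullet> (\<beta>1 - \<beta>2))" for i
  proof (cases "X i \<omega> \<bullet> \<beta>1 \<le> X i \<omega> \<bullet> \<beta>2")
    case True
    then have "?F i \<beta>1 \<le> ?F i \<beta>2"
      using assms by (intro monoD[OF kernel_cdf_mono] divide_right_mono) auto
    with True show ?thesis by (intro mult_nonpos_nonpos) (auto simp: inner_diff_right)
  next
    case False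
    then have "?F i \<beta>2 \<le> ?F i \<beta>1"
      using assms by (intro monoD[OF kernel_cdf_mono] divide_right_mono) auto
    with False show ?thesis by (intro mult_nonneg_nonneg) (auto simp: inner_diff_right)
  qed
  then have "0 \<le> (\<Sum>i<n. (?F i \<beta>1 - ?F i \<beta>2) * (X i \<omega> \<bullet> (\<beta>1 - \<beta>2))) / real n"
    by (intro divide_nonneg_nonneg sum_nonneg) auto
  also have "\<dots> = (grad_Qhat \<tau> K h n X Y \<omega> \<beta>1 - grad_Qhat \<tau> K h n X Y \<omega> \<beta>2) \<bullet> (\<beta>1 - \<beta>2)"
    by (simp add: grad_Qhat_def scaleR_diff_right[symmetric] sum_subtractf[symmetric]
          scaleR_diff_left[symmetric] inner_sum_left)
  finally show ?thesis .
qed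

lemma GDERIV_directional:
  assumes "GDERIV Q \<beta> :> g"
  shows "((\<lambda>t. Q (\<beta> + t *\<^sub>R d)) has_real_derivative (g \<bullet> d)) (at 0)"
proof -
  have Q: "(Q has_derivative (\<lambda>v. v \<bullet> g)) (at (\<beta> + 0 *\<^sub>R d))"
    using assms by (simp add: gderiv_def inner_commute)
  have "((\<lambda>t::real. \<beta> + t *\<^sub>R d) has_derivative (\<lambda>t. t *\<^sub>R d)) (at 0)"
    by (auto intro!: derivative_eq_intros)
  from has_derivative_compose[OF this Q]
  show ?thesis
    by (simp add: has_field_derivative_def inner_commute mult_commute_abs)
qed

text \<open>By convexity, moving a fraction \<open>t\<close> from \<open>\<beta>\<close> toward
  \<open>u\<close> raises \<open>P\<close> by at most \<open>t * (P u - P \<beta>)\<close>. Dividing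
  by \<open>t\<close> and letting \<open>t\<close> tend to 0 turns the increment of \<open>Q\<close>
  into its derivative, without subgradients of \<open>P\<close>.\<close>

lemma arg_min_variational_inequality:
  assumes min: "is_arg_min (\<lambda>\<beta>. Q \<beta> + P \<beta>) (\<lambda>_. True) \<beta>"
    and Q: "GDERIV Q \<beta> :> g" and P: "convex_on UNIV P"
  shows "g \<bullet> (\<beta> - u) \<le> P u - P \<beta>"
proof -
  let ?d = "u - \<beta>"
  have "((\<lambda>t. (Q (\<beta> + t *\<^sub>R ?d) - Q \<beta>) / t) \<longlongrightarrow> g \<bullet> ?d) (at_right 0)"
    using GDERIV_directional[OF Q, of ?d] unfolding has_field_derivative_iff
    by (auto intro: tendsto_mono[OF at_le])
  moreover have "eventually (\<lambda>t. P \<beta> - P u \<le> (Q (\<beta> + t *\<^sub>R ?d) - Q \<beta>) / t) (at_right (0::real))"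
    unfolding eventually_at_right_field
  proof (intro exI[of _ 1] conjI allI impI)
    fix t :: real assume t: "0 < t" "t < 1"
    let ?u = "\<beta> + t *\<^sub>R ?d"
    have "Q \<beta> + P \<beta> \<le> Q ?u + P ?u"
      using min by (auto simp: is_arg_min_def not_less)
    moreover have "P ?u \<le> (1 - t) * P \<beta> + t * P u"
      using convex_onD[OF P, of t \<beta> u] t by (simp add: algebra_simps)
    ultimately have "t * (P \<beta> - P u) \<le> Q ?u - Q \<beta>"
      by (simp add: algebra_simps)
    then show "P \<beta> - P u \<le> (Q ?u - Q \<beta>) / t"
      using t by (simp add: field_simps)
  qed simp
  ultimately have "P \<beta> - P u \<le> g \<bullet> ?d"
    by (rule tendsto_lowerbound) simp
  then show ?thesis by (simp add: inner_diff_right)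
qed

lemma norm_square_sum: "(norm v)\<^sup>2 = (\<Sum>j\<in>UNIV. (v $ j)\<^sup>2)"
  for v :: "real ^ 'p"
  by (simp add: norm_vec_def L2_set_def sum_nonneg)

text \<open>Moving along a coordinate axis in \<open>S\<close> keeps the constraint, so on that line
  \<open>Q\<close> is minimal at \<open>t = 0\<close>.\<close>

lemma oracle_gradient_zero:
  fixes b :: "real ^ 'p"
  assumes ora: "is_oracle_estimator Q S b" and Q: "GDERIV Q b :> g" and j: "j \<in> S"
  shows "g $ j = 0"
proof -
  have D: "((\<lambda>t. Q (b + t *\<^sub>R axis j 1)) has_real_derivative (g \<bullet> axis j 1)) (at 0)"
    by (rule GDERIV_directional[OF Q])
  have "Q b \<le> Q (b + t *\<^sub>R axis j 1)" for t
  proof -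
    have "\<forall>i. i \<notin> S \<longrightarrow> (b + t *\<^sub>R axis j 1) $ i = 0"
      using ora j by (auto simp: is_oracle_estimator_def is_arg_min_def axis_def)
    then show ?thesis
      using ora unfolding is_oracle_estimator_def is_arg_min_def by (metis not_less)
  qed
  then have "g \<bullet> axis j 1 = 0"
    by (intro DERIV_local_min[OF D, of 1]) auto
  then show ?thesis by (simp add: inner_axis)
qed

lemma convex_reweighted_l1:
  fixes \<beta>0 :: "real ^ 'p"
  assumes "\<And>t. 0 \<le> t \<Longrightarrow> 0 \<le> q' t" "0 < lam"
  shows "convex_on UNIV (reweighted_l1 q' lam \<beta>0)"
proof (rule convex_onI)
  fix t :: real and u v :: "real ^ 'p" assume t: "0 < t" "t < 1"
  have "\<bar>((1 - t) *\<^sub>R u + t *\<^sub>R v) $ j\<bar> \<le> (1 - t) * \<bar>u $ j\<bar> + t * \<bar>v $ j\<bar>" for j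
    using abs_triangle_ineq[of "(1 - t) * u $ j" "t * v $ j"] t by (simp add: abs_mult)
  moreover have "0 \<le> scaled_penalty_deriv q' lam \<bar>\<beta>0 $ j\<bar>" for j
    using assms by (simp add: scaled_penalty_deriv_def)
  ultimately have "reweighted_l1 q' lam \<beta>0 ((1 - t) *\<^sub>R u + t *\<^sub>R v) \<le>
      (\<Sum>j\<in>UNIV. scaled_penalty_deriv q' lam \<bar>\<beta>0 $ j\<bar> * ((1 - t) * \<bar>u $ j\<bar> + t * \<bar>v $ j\<bar>))"
    unfolding reweighted_l1_def by (intro sum_mono mult_left_mono) auto
  also have "\<dots> = (1 - t) * reweighted_l1 q' lam \<beta>0 u + t * reweighted_l1 q' lam \<beta>0 v"
    unfolding reweighted_l1_def sum_distrib_left sum.distrib[symmetric]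
    by (intro sum.cong) (auto simp: algebra_simps)
  finally show "reweighted_l1 q' lam \<beta>0 ((1 - t) *\<^sub>R u + t *\<^sub>R v) \<le>
      (1 - t) * reweighted_l1 q' lam \<beta>0 u + t * reweighted_l1 q' lam \<beta>0 v" .
qed simp

section \<open>One reweighting step around the oracle\<close>

text \<open>The deterministic situation at one sample point of the event: \<open>N\<close> is the
  weighted norm, and \<open>rsc\<close> is restricted strong convexity with its second argument
  fixed at the oracle estimator \<open>bo\<close>.\<close>

locale oracle_reweighting =
  fixes Q :: "real ^ 'p \<Rightarrow> real" and g :: "real ^ 'p \<Rightarrow> real ^ 'p" and N :: "real ^ 'p \<Rightarrow> real"
    and q' :: "real \<Rightarrow> real" and S :: "'p set" and bo \<beta>star :: "real ^ 'p"
    and lam \<delta> \<kappa> \<alpha>0 \<alpha>1 r l c1 \<gamma> :: real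
  assumes deriv: "\<And>\<beta>. GDERIV Q \<beta> :> g \<beta>"
    and mono: "\<And>\<beta>1 \<beta>2. 0 \<le> (g \<beta>1 - g \<beta>2) \<bullet> (\<beta>1 - \<beta>2)"
    and N_scaleR: "\<And>c v. N (c *\<^sub>R v) = \<bar>c\<bar> * N v"
    and N_ge: "\<And>v. sqrt \<gamma> * norm v \<le> N v"
    and rsc: "\<And>\<beta>. N (\<beta> - bo) \<le> r \<Longrightarrow> l1norm (\<beta> - bo) \<le> l * N (\<beta> - bo) \<Longrightarrow>
      \<kappa> * (N (\<beta> - bo))\<^sup>2 \<le> (g \<beta> - g bo) \<bullet> (\<beta> - bo)"
    and ora: "is_oracle_estimator Q S bo"
    and grad_bound: "\<And>j. \<bar>g bo $ j\<bar> \<le> q' \<alpha>0 * lam / 2"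
    and ora_error: "\<And>j. \<bar>bo $ j - \<beta>star $ j\<bar> \<le> (\<alpha>0 - 1 / (\<delta> * \<kappa> * \<gamma>)) * lam"
    and beta_min: "\<And>j. j \<in> S \<Longrightarrow> (\<alpha>0 + \<alpha>1) * lam \<le> \<bar>\<beta>star $ j\<bar>"
    and q'_bounds: "\<And>t. 0 \<le> t \<Longrightarrow> 0 \<le> q' t \<and> q' t \<le> 1"
    and q'_antimono: "\<And>t1 t2. 0 \<le> t2 \<Longrightarrow> t2 \<le> t1 \<Longrightarrow> q' t1 \<le> q' t2"
    and q'_0: "q' 0 = 1"
    and pos: "0 < lam" "0 < \<delta>" "\<delta> < 1" "0 < \<kappa>" "0 < \<gamma>" "0 < \<alpha>0" "\<alpha>0 < \<alpha>1" "0 < q' \<alpha>0" "0 < c1"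
    and alpha0: "1 / (\<delta> * \<kappa> * \<gamma>) < \<alpha>0"
    and alpha1: "q' \<alpha>1 = 0"
    and c1: "q' \<alpha>0 / 2 * sqrt (c1\<^sup>2 + 1) + 1 = \<alpha>0 * \<kappa> * \<gamma> * c1"
    and r: "sqrt \<gamma> * \<alpha>0 * c1 * sqrt (card S) * lam \<le> r"
    and l: "l = (2 + 2 / q' \<alpha>0) * sqrt (c1\<^sup>2 + 1) * sqrt (card S / \<gamma>)"
begin

abbreviation a :: real where "a \<equiv> q' \<alpha>0"

abbreviation \<theta> :: real where "\<theta> \<equiv> 1 / (\<delta> * \<kappa> * \<gamma>)"

abbreviation wt :: "real ^ 'p \<Rightarrow> 'p \<Rightarrow> real" where
  "wt \<beta> j \<equiv> scaled_penalty_deriv q' lam \<bar>\<beta> $ j\<bar>"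

definition active :: "real ^ 'p \<Rightarrow> 'p set" where
  "active \<beta> = S \<union> {j. wt \<beta> j < a * lam}"

text \<open>The vector \<open>v\<close> of the introduction, with \<open>active\<close> as the set
  \<open>E\<close>: its entries are the coefficients of the error left in each coordinate after the
  penalty is balanced against the oracle gradient.\<close>

definition excess :: "real ^ 'p \<Rightarrow> real ^ 'p" where
  "excess \<beta> = (\<chi> j. if j \<in> S then wt \<beta> j else if j \<in> active \<beta> then a * lam / 2 else 0)"

section \<open>Size and support of the excess vector\<close>

lemma a_le_1: "a \<le> 1"
  using q'_bounds[of \<alpha>0] pos by simp

lemma wt_bounds: "0 \<le> wt \<beta> j" "wt \<beta> j \<le> lam"
  using q'_bounds[of "\<bar>\<beta> $ j\<bar> / lam"] pos
  by (auto simp: scaled_penalty_deriv_def mult_le_cancel_left1)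

lemma bo_outside: "j \<notin> S \<Longrightarrow> bo $ j = 0"
  using ora by (auto simp: is_oracle_estimator_def is_arg_min_def)

lemma grad_inside: "j \<in> S \<Longrightarrow> g bo $ j = 0"
  using oracle_gradient_zero[OF ora deriv] .

lemma excess_bounds: "0 \<le> excess \<beta> $ j" "excess \<beta> $ j \<le> lam"
proof -
  have "a * lam \<le> lam" using a_le_1 pos by simp
  then show "0 \<le> excess \<beta> $ j" "excess \<beta> $ j \<le> lam"
    using wt_bounds[of \<beta> j] pos by (auto simp: excess_def)
qed

text \<open>The weight is non-increasing in the size of the coordinate and equals
  \<open>a * lam\<close> at size \<open>\<alpha>0 * lam\<close>; off \<open>S\<close> that size is
  the error, because \<open>bo\<close> vanishes there.\<close>

lemma active_outside_large:
  assumes "j \<in> active \<beta> - S"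
  shows "\<alpha>0 * lam < \<bar>\<beta> $ j - bo $ j\<bar>"
proof (rule ccontr)
  assume "\<not> ?thesis"
  then have "\<bar>\<beta> $ j\<bar> / lam \<le> \<alpha>0" using assms pos bo_outside[of j] by (simp add: field_simps)
  then have "a \<le> q' (\<bar>\<beta> $ j\<bar> / lam)" using pos by (intro q'_antimono) auto
  then have "a * lam \<le> wt \<beta> j" using pos by (simp add: scaled_penalty_deriv_def)
  then show False using assms by (auto simp: active_def)
qed

text \<open>A coordinate within \<open>\<theta> * lam\<close> of \<open>bo\<close> is within
  \<open>\<alpha>0 * lam\<close> of \<open>\<beta>star\<close>, so the beta-min condition keeps its
  size above \<open>\<alpha>1 * lam\<close>, where \<open>q'\<close> is zero.\<close>

lemma wt_inside_pos_large:
  assumes "j \<in> S" "wt \<beta> j \<noteq> 0"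
  shows "\<theta> * lam < \<bar>\<beta> $ j - bo $ j\<bar>"
proof (rule ccontr)
  assume "\<not> ?thesis"
  then have "\<bar>\<beta> $ j - \<beta>star $ j\<bar> \<le> \<alpha>0 * lam"
    using ora_error[of j] by (simp add: algebra_simps)
  then have "\<alpha>1 * lam \<le> \<bar>\<beta> $ j\<bar>" using beta_min[OF assms(1)] by (simp add: algebra_simps)
  then have "\<alpha>1 \<le> \<bar>\<beta> $ j\<bar> / lam" using pos by (simp add: field_simps)
  then have "q' (\<bar>\<beta> $ j\<bar> / lam) \<le> 0" using pos alpha1 q'_antimono[of \<alpha>1] by auto
  then have "q' (\<bar>\<beta> $ j\<bar> / lam) = 0" using q'_bounds[of "\<bar>\<beta> $ j\<bar> / lam"] pos by auto
  with assms(2) show False by (simp add: scaled_penalty_deriv_def)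
qed

lemma excess_nonzero_large:
  assumes "excess \<beta> $ j \<noteq> 0"
  shows "\<theta> * lam < \<bar>\<beta> $ j - bo $ j\<bar>"
proof (cases "j \<in> S")
  case True
  with assms show ?thesis by (intro wt_inside_pos_large) (auto simp: excess_def)
next
  case False
  with assms have "j \<in> active \<beta> - S" by (auto simp: excess_def split: if_splits)
  moreover have "\<theta> * lam < \<alpha>0 * lam" using alpha0 pos by (intro mult_strict_right_mono) auto
  ultimately show ?thesis using active_outside_large[of j \<beta>] by linarith
qed

text \<open>Coordinatewise: an entry is at most \<open>lam\<close>, and where it is nonzero the
  error exceeds \<open>\<theta> * lam\<close>. This is the source of the contraction factor
  \<open>\<delta>\<close>.\<close>

lemma excess_le_error: "norm (excess \<beta>) \<le> \<delta> * \<kappa> * \<gamma> * norm (\<beta> - bo)"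
proof -
  have "norm (excess \<beta>) \<le> norm ((\<delta> * \<kappa> * \<gamma>) *\<^sub>R (\<beta> - bo))"
  proof (rule norm_le_componentwise_cart)
    fix j
    show "norm (excess \<beta> $ j) \<le> norm (((\<delta> * \<kappa> * \<gamma>) *\<^sub>R (\<beta> - bo)) $ j)"
    proof (cases "excess \<beta> $ j = 0")
      case False
      have "lam \<le> \<delta> * \<kappa> * \<gamma> * \<bar>\<beta> $ j - bo $ j\<bar>"
        using excess_nonzero_large[OF False] pos by (simp add: field_simps)
      with excess_bounds[of \<beta> j] pos show ?thesis by (simp add: abs_mult)
    qed simp
  qed
  also have "\<dots> = \<delta> * \<kappa> * \<gamma> * norm (\<beta> - bo)" using pos by simp
  finally show ?thesis .
qed

lemma excess_eq_0:
  assumes "norm (\<beta> - bo) \<le> \<theta> * lam"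
  shows "excess \<beta> = 0"
proof -
  have "excess \<beta> $ j = 0" for j
    using excess_nonzero_large[of \<beta> j] component_le_norm_cart[of "\<beta> - bo" j] assms by force
  then show ?thesis by (simp add: vec_eq_iff)
qed

text \<open>Counting as in Chebyshev's inequality: each active coordinate off \<open>S\<close> adds
  more than \<open>(\<alpha>0 * lam)\<^sup>2\<close> to the squared error.\<close>

lemma card_active_outside:
  assumes "norm (\<beta> - bo) \<le> \<alpha>0 * c1 * sqrt (card S) * lam"
  shows "real (card (active \<beta> - S)) \<le> c1\<^sup>2 * card S"
proof -
  let ?A = "active \<beta> - S"
  have "real (card ?A) * (\<alpha>0 * lam)\<^sup>2 = (\<Sum>j\<in>?A. (\<alpha>0 * lam)\<^sup>2)" by simp
  also have "\<dots> \<le> (\<Sum>j\<in>?A. \<bar>\<beta> $ j - bo $ j\<bar>\<^sup>2)"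
    using active_outside_large[of _ \<beta>] pos by (intro sum_mono power_mono) force+
  also have "\<dots> \<le> (\<Sum>j\<in>UNIV. \<bar>\<beta> $ j - bo $ j\<bar>\<^sup>2)" by (intro sum_mono2) auto
  also have "\<dots> = (norm (\<beta> - bo))\<^sup>2"
    by (simp add: norm_square_sum)
  also have "\<dots> \<le> (\<alpha>0 * c1 * sqrt (card S) * lam)\<^sup>2" using assms by (rule power_mono) simp
  also have "\<dots> = c1\<^sup>2 * card S * (\<alpha>0 * lam)\<^sup>2" by (simp add: power_mult_distrib)
  finally show ?thesis using pos by simp
qed

lemma norm_excess_sq:
  "(norm (excess \<beta>))\<^sup>2 = (\<Sum>j\<in>S. (wt \<beta> j)\<^sup>2) + real (card (active \<beta> - S)) * (a * lam / 2)\<^sup>2"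
proof -
  have "(norm (excess \<beta>))\<^sup>2 = (\<Sum>j\<in>UNIV. (excess \<beta> $ j)\<^sup>2)"
    by (rule norm_square_sum)
  also have "\<dots> = (\<Sum>j\<in>S \<union> (active \<beta> - S). (excess \<beta> $ j)\<^sup>2)"
    by (intro sum.mono_neutral_right) (auto simp: excess_def)
  also have "\<dots> = (\<Sum>j\<in>S. (excess \<beta> $ j)\<^sup>2) + (\<Sum>j\<in>active \<beta> - S. (excess \<beta> $ j)\<^sup>2)"
    by (intro sum.union_disjoint) auto
  also have "(\<Sum>j\<in>active \<beta> - S. (excess \<beta> $ j)\<^sup>2) = (\<Sum>j\<in>active \<beta> - S. (a * lam / 2)\<^sup>2)"
    by (intro sum.cong) (auto simp: excess_def)
  finally show ?thesis by (simp add: excess_def)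
qed

lemma norm_excess_le:
  assumes "real (card (active \<beta> - S)) \<le> c1\<^sup>2 * card S"
  shows "norm (excess \<beta>) \<le> lam * sqrt (card S) * sqrt (1 + (a * c1 / 2)\<^sup>2)"
proof (rule power2_le_imp_le)
  have "(\<Sum>j\<in>S. (wt \<beta> j)\<^sup>2) \<le> (\<Sum>j\<in>S. lam\<^sup>2)"
    using wt_bounds by (intro sum_mono power_mono) auto
  moreover have "real (card (active \<beta> - S)) * (a * lam / 2)\<^sup>2 \<le> c1\<^sup>2 * card S * (a * lam / 2)\<^sup>2"
    using assms by (intro mult_right_mono) auto
  ultimately have "(norm (excess \<beta>))\<^sup>2 \<le> card S * lam\<^sup>2 + c1\<^sup>2 * card S * (a * lam / 2)\<^sup>2"
    by (simp add: norm_excess_sq)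
  also have "\<dots> = (lam * sqrt (card S) * sqrt (1 + (a * c1 / 2)\<^sup>2))\<^sup>2"
    by (simp add: power_mult_distrib power_divide algebra_simps)
  finally show "(norm (excess \<beta>))\<^sup>2 \<le> (lam * sqrt (card S) * sqrt (1 + (a * c1 / 2)\<^sup>2))\<^sup>2" .
qed (use pos in simp)

text \<open>The equation for \<open>c1\<close> enters here. Strictness comes from
  \<open>sqrt (1 + z\<^sup>2) < 1 + z\<close> for \<open>z > 0\<close>, and later yields a strict
  comparison with the radius \<open>r\<close>.\<close>

lemma sqrt_less_c1: "sqrt (1 + (a * c1 / 2)\<^sup>2) < \<alpha>0 * \<kappa> * \<gamma> * c1"
proof -
  have "0 < a * c1" using pos by simp
  then have "1 + (a * c1 / 2)\<^sup>2 < (1 + a * c1 / 2)\<^sup>2" by (simp add: power2_eq_square algebra_simps)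
  then have "sqrt (1 + (a * c1 / 2)\<^sup>2) < 1 + a * c1 / 2"
    using \<open>0 < a * c1\<close> by (intro real_less_lsqrt) auto
  moreover have "a / 2 * c1 \<le> a / 2 * sqrt (c1\<^sup>2 + 1)"
    using pos by (intro mult_left_mono real_le_rsqrt) auto
  ultimately show ?thesis unfolding c1[symmetric] by simp
qed

section \<open>Basic inequality, cone condition and error bound for one step\<close>

text \<open>On \<open>S\<close> the oracle gradient vanishes and the penalty costs at most the
  weight. On the other active coordinates the penalty has a favourable sign and only the gradient
  bound remains. Elsewhere a weight of at least \<open>a * lam\<close> beats the gradient and leaves
  half of it.\<close>

lemma gradient_gap:
  assumes min: "is_arg_min (\<lambda>\<beta>. Q \<beta> + reweighted_l1 q' lam \<beta>0 \<beta>) (\<lambda>_. True) \<beta>"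
  shows "(g \<beta> - g bo) \<bullet> (\<beta> - bo) \<le>
    (\<Sum>j\<in>active \<beta>0. excess \<beta>0 $ j * \<bar>(\<beta> - bo) $ j\<bar>) - a * lam / 2 * (\<Sum>j\<in>- active \<beta>0. \<bar>(\<beta> - bo) $ j\<bar>)"
proof -
  let ?D = "\<beta> - bo" and ?E = "active \<beta>0"
  \<comment> \<open>The contribution of coordinate \<open>j\<close> to the variational inequality at
    \<open>u = bo\<close>, after subtracting the inner product of \<open>g bo\<close> with the
    error.\<close>
  define T where "T j = wt \<beta>0 j * (\<bar>bo $ j\<bar> - \<bar>\<beta> $ j\<bar>) - g bo $ j * ?D $ j" for j
  have gD: "- (g bo $ j * ?D $ j) \<le> a * lam / 2 * \<bar>?D $ j\<bar>" for j
  proof -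
    have "- (g bo $ j * ?D $ j) \<le> \<bar>g bo $ j\<bar> * \<bar>?D $ j\<bar>" by (simp add: abs_mult[symmetric])
    also have "\<dots> \<le> a * lam / 2 * \<bar>?D $ j\<bar>" using grad_bound by (intro mult_right_mono) auto
    finally show ?thesis .
  qed
  have T_S: "T j \<le> excess \<beta>0 $ j * \<bar>?D $ j\<bar>" if "j \<in> S" for j
  proof -
    have "wt \<beta>0 j * (\<bar>bo $ j\<bar> - \<bar>\<beta> $ j\<bar>) \<le> wt \<beta>0 j * \<bar>?D $ j\<bar>"
      using wt_bounds by (intro mult_left_mono) auto
    then show ?thesis using that by (simp add: T_def excess_def grad_inside)
  qed
  have T_E: "T j \<le> excess \<beta>0 $ j * \<bar>?D $ j\<bar>" if "j \<in> ?E" "j \<notin> S" for j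
  proof -
    have "0 \<le> wt \<beta>0 j * \<bar>\<beta> $ j\<bar>" using wt_bounds by (intro mult_nonneg_nonneg) auto
    then show ?thesis using gD[of j] that by (simp add: T_def excess_def bo_outside)
  qed
  have T_out: "T j \<le> - (a * lam / 2 * \<bar>?D $ j\<bar>)" if "j \<notin> ?E" for j
  proof -
    have "a * lam * \<bar>\<beta> $ j\<bar> \<le> wt \<beta>0 j * \<bar>\<beta> $ j\<bar>"
      using that by (intro mult_right_mono) (auto simp: active_def)
    moreover have "j \<notin> S" using that by (auto simp: active_def)
    ultimately show ?thesis using gD[of j] by (simp add: T_def bo_outside)
  qed
  have "g \<beta> \<bullet> ?D \<le> reweighted_l1 q' lam \<beta>0 bo - reweighted_l1 q' lam \<beta>0 \<beta>"
    using q'_bounds pos by (intro arg_min_variational_inequality[OF min deriv] convex_reweighted_l1) auto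
  then have "(g \<beta> - g bo) \<bullet> ?D \<le> (\<Sum>j\<in>UNIV. T j)"
    unfolding T_def reweighted_l1_def inner_diff_left
    by (simp add: inner_vec_def sum_subtractf right_diff_distrib)
  also have "\<dots> = (\<Sum>j\<in>?E. T j) + (\<Sum>j\<in>- ?E. T j)"
    by (subst sum.union_disjoint[symmetric]) (auto simp: Compl_partition)
  also have "\<dots> \<le> (\<Sum>j\<in>?E. excess \<beta>0 $ j * \<bar>?D $ j\<bar>) + (\<Sum>j\<in>- ?E. - (a * lam / 2 * \<bar>?D $ j\<bar>))"
    using T_S T_E T_out by (intro add_mono sum_mono) blast+
  finally show ?thesis by (simp add: sum_negf sum_distrib_left)
qed

text \<open>Monotonicity makes the left side of \<open>gradient_gap\<close> nonnegative, so the mass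
  off the active set is controlled by the mass on it; Cauchy-Schwarz and the cardinality bound do
  the rest.\<close>

lemma l1norm_error_le:
  assumes min: "is_arg_min (\<lambda>\<beta>. Q \<beta> + reweighted_l1 q' lam \<beta>0 \<beta>) (\<lambda>_. True) \<beta>"
    and card: "real (card (active \<beta>0 - S)) \<le> c1\<^sup>2 * card S"
  shows "l1norm (\<beta> - bo) \<le> l * N (\<beta> - bo)"
proof -
  let ?D = "\<beta> - bo" and ?E = "active \<beta>0"
  let ?in = "\<Sum>j\<in>?E. \<bar>?D $ j\<bar>" and ?out = "\<Sum>j\<in>- ?E. \<bar>?D $ j\<bar>"
  have "(\<Sum>j\<in>?E. excess \<beta>0 $ j * \<bar>?D $ j\<bar>) \<le> (\<Sum>j\<in>?E. lam * \<bar>?D $ j\<bar>)"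
    using excess_bounds by (intro sum_mono mult_right_mono) auto
  then have "a * lam / 2 * ?out \<le> lam * ?in"
    using gradient_gap[OF min] mono[of \<beta> bo] by (simp add: sum_distrib_left)
  then have "?out \<le> 2 / a * ?in" using pos by (simp add: field_simps)
  moreover have "l1norm ?D = ?in + ?out"
    unfolding l1norm_def by (subst sum.union_disjoint[symmetric]) (auto simp: Compl_partition)
  moreover have "0 \<le> ?in" by (simp add: sum_nonneg)
  \<comment> \<open>The sum gives the factor \<open>1 + 2 / a\<close>, enlarged here to the one
    occurring in \<open>l\<close>.\<close>
  ultimately have "l1norm ?D \<le> (2 + 2 / a) * ?in"
    unfolding distrib_right by linarith
  also have "?in \<le> sqrt (c1\<^sup>2 + 1) * sqrt (card S) * norm ?D"
  proof -
    have "?in = (\<Sum>j\<in>?E. \<bar>1\<bar> * \<bar>?D $ j\<bar>)" by simp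
    also have "\<dots> \<le> L2_set (\<lambda>_. 1) ?E * L2_set (\<lambda>j. ?D $ j) ?E" by (rule L2_set_mult_ineq)
    also have "\<dots> \<le> sqrt (card ?E) * norm ?D"
      by (intro mult_mono) (auto simp: L2_set_def norm_vec_def intro!: sum_mono2 sum_nonneg)
    also have "card ?E \<le> (c1\<^sup>2 + 1) * card S"
    proof -
      have "card ?E = card S + card (?E - S)"
        by (subst card_Un_disjoint[symmetric]) (auto simp: active_def intro: arg_cong[where f = card])
      then show ?thesis using card by (simp add: algebra_simps)
    qed
    finally show ?thesis by (simp add: real_sqrt_mult mult_right_mono)
  qed
  also have "norm ?D \<le> N ?D / sqrt \<gamma>" using N_ge[of ?D] pos by (simp add: field_simps)
  finally have "l1norm ?D \<le> (2 + 2 / a) * (sqrt (c1\<^sup>2 + 1) * sqrt (card S) * (N ?D / sqrt \<gamma>))"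
    using pos by (simp add: mult_left_mono)
  then show ?thesis by (simp add: l real_sqrt_divide mult.assoc)
qed

text \<open>
  The a priori bound \<open>N (\<beta> - bo) \<le> r\<close> comes from applying restricted strong convexity at the point
  of the segment from \<open>bo\<close> to \<open>\<beta>\<close> at distance exactly \<open>r\<close>.
\<close>

lemma error_bound_from_cone:
  assumes gap: "(g \<beta> - g bo) \<bullet> (\<beta> - bo) \<le> V * norm (\<beta> - bo)"
    and cone: "l1norm (\<beta> - bo) \<le> l * N (\<beta> - bo)"
    and V: "0 \<le> V" "V < \<kappa> * sqrt \<gamma> * r"
  shows "\<kappa> * \<gamma> * norm (\<beta> - bo) \<le> V"
proof -
  let ?D = "\<beta> - bo"
  have r_pos: "0 < r"
    using V pos by (smt (verit) mult_nonneg_nonpos mult_pos_pos real_sqrt_gt_zero)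
  have N_nonneg: "0 \<le> N ?D"
    using N_ge[of ?D] pos by (smt (verit) mult_nonneg_nonneg norm_ge_zero real_sqrt_ge_zero)
  have gap': "(g \<beta> - g bo) \<bullet> ?D \<le> V / sqrt \<gamma> * N ?D"
  proof -
    have "norm ?D \<le> N ?D / sqrt \<gamma>" using N_ge[of ?D] pos by (simp add: field_simps)
    from mult_left_mono[OF this V(1)] gap show ?thesis by simp
  qed
  have "N ?D \<le> r"
  proof (rule ccontr)
    assume "\<not> N ?D \<le> r"
    then have big: "r < N ?D" by simp
    define \<eta> where "\<eta> = r / N ?D"
    have \<eta>: "0 < \<eta>" "\<eta> < 1" using r_pos big by (auto simp: \<eta>_def)
    let ?b = "bo + \<eta> *\<^sub>R ?D"
    have N_b: "N (?b - bo) = r" using \<eta> N_nonneg big r_pos by (simp add: N_scaleR \<eta>_def)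
    have "l1norm (?b - bo) = \<eta> * l1norm ?D"
      using \<eta> by (simp add: l1norm_def abs_mult sum_distrib_left flip: right_diff_distrib)
    also have "\<dots> \<le> \<eta> * (l * N ?D)" using cone \<eta> by (intro mult_left_mono) auto
    also have "\<dots> = l * N (?b - bo)" using \<eta> by (simp add: N_scaleR)
    finally have "\<kappa> * r\<^sup>2 \<le> (g ?b - g bo) \<bullet> (?b - bo)"
      using rsc[of ?b] N_b by simp
    also have "\<dots> \<le> \<eta> * ((g \<beta> - g bo) \<bullet> ?D)"
    proof -
      \<comment> \<open>Monotonicity between \<open>?b\<close> and \<open>\<beta>\<close>, whose
        difference is a positive multiple of \<open>?D\<close>, compares the two gradient
        gaps.\<close>
      have "\<beta> - ?b = (1 - \<eta>) *\<^sub>R ?D" by (simp add: algebra_simps)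
      with mono[of \<beta> ?b] have "0 \<le> (1 - \<eta>) * ((g \<beta> - g ?b) \<bullet> ?D)" by simp
      with \<eta> have "0 \<le> (g \<beta> - g ?b) \<bullet> ?D" by (simp add: zero_le_mult_iff)
      with \<eta> have "\<eta> * ((g ?b - g bo) \<bullet> ?D) \<le> \<eta> * ((g \<beta> - g bo) \<bullet> ?D)"
        by (intro mult_left_mono) (auto simp: inner_diff_left)
      then show ?thesis by simp
    qed
    also have "\<dots> \<le> \<eta> * (V / sqrt \<gamma> * N ?D)" using gap' \<eta> by (intro mult_left_mono) auto
    also have "\<dots> = V / sqrt \<gamma> * r" using r_pos big by (simp add: \<eta>_def)
    finally have "\<kappa> * r \<le> V / sqrt \<gamma>"
      using mult_le_cancel_right_pos[OF r_pos, of "\<kappa> * r" "V / sqrt \<gamma>"]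
      by (simp add: power2_eq_square mult.assoc)
    with V(2) pos show False by (simp add: field_simps)
  qed
  from rsc[OF this cone] gap' have NN: "\<kappa> * (N ?D)\<^sup>2 \<le> V / sqrt \<gamma> * N ?D" by simp
  have "\<kappa> * N ?D \<le> V / sqrt \<gamma>"
  proof (cases "N ?D = 0")
    case False
    with N_nonneg have "0 < N ?D" by simp
    from mult_le_cancel_right_pos[OF this, of "\<kappa> * N ?D" "V / sqrt \<gamma>"] NN
    show ?thesis by (simp add: power2_eq_square mult.assoc)
  qed (use V pos in simp)
  \<comment> \<open>Each passage between \<open>N\<close> and the Euclidean norm costs
    \<open>sqrt \<gamma>\<close>; two of them produce \<open>\<gamma>\<close>.\<close>
  then have "\<kappa> * sqrt \<gamma> * N ?D \<le> V" using pos by (simp add: field_simps)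
  moreover have "\<kappa> * sqrt \<gamma> * (sqrt \<gamma> * norm ?D) \<le> \<kappa> * sqrt \<gamma> * N ?D"
    using N_ge pos by (intro mult_left_mono) auto
  moreover have "\<kappa> * sqrt \<gamma> * (sqrt \<gamma> * norm ?D) = \<kappa> * \<gamma> * norm ?D" using pos by simp
  ultimately show ?thesis by linarith
qed

lemma reweighting_step:
  assumes min: "is_arg_min (\<lambda>\<beta>. Q \<beta> + reweighted_l1 q' lam \<beta>0 \<beta>) (\<lambda>_. True) \<beta>"
    and card: "real (card (active \<beta>0 - S)) \<le> c1\<^sup>2 * card S"
  shows "\<kappa> * \<gamma> * norm (\<beta> - bo) \<le> norm (excess \<beta>0)"
proof (cases "S = {}")
  \<comment> \<open>Here the strict bound on the excess may fail, since \<open>r\<close> may be 0;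
    but \<open>l = 0\<close>, so the cone alone forces the error to vanish.\<close>
  case True
  then have "(\<Sum>j\<in>UNIV. \<bar>(\<beta> - bo) $ j\<bar>) \<le> 0"
    using l1norm_error_le[OF assms] by (simp add: l l1norm_def)
  then have "norm (\<beta> - bo) \<le> 0" using norm_le_l1_cart order_trans by blast
  then show ?thesis by simp
next
  case False
  let ?D = "\<beta> - bo"
  have S: "0 < sqrt (card S)" using False by (simp add: card_gt_0_iff)
  show ?thesis
  proof (rule error_bound_from_cone[OF _ l1norm_error_le[OF assms]])
    have "(\<Sum>j\<in>- active \<beta>0. \<bar>?D $ j\<bar>) * (a * lam) \<ge> 0"
      using pos by (intro mult_nonneg_nonneg sum_nonneg) auto
    then have "(g \<beta> - g bo) \<bullet> ?D \<le> (\<Sum>j\<in>active \<beta>0. excess \<beta>0 $ j * \<bar>?D $ j\<bar>)"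
      using gradient_gap[OF min] by (simp add: algebra_simps)
    also have "\<dots> \<le> (\<Sum>j\<in>UNIV. \<bar>excess \<beta>0 $ j\<bar> * \<bar>?D $ j\<bar>)"
      using excess_bounds by (simp add: sum_mono2)
    also have "\<dots> \<le> norm (excess \<beta>0) * norm ?D"
      using L2_set_mult_ineq[of "($) (excess \<beta>0)" "($) ?D" UNIV] by (simp add: norm_vec_def L2_set_def)
    finally show "(g \<beta> - g bo) \<bullet> ?D \<le> norm (excess \<beta>0) * norm ?D" .
    \<comment> \<open>The lower bound on \<open>r\<close> is matched to this estimate, which makes
      restricted strong convexity available.\<close>
    have "norm (excess \<beta>0) < lam * sqrt (card S) * (\<alpha>0 * \<kappa> * \<gamma> * c1)"
      using norm_excess_le[OF card] mult_strict_left_mono[OF sqrt_less_c1, of "lam * sqrt (card S)"]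
        S pos by (meson le_less_trans mult_pos_pos)
    also have "\<dots> = \<kappa> * sqrt \<gamma> * (sqrt \<gamma> * \<alpha>0 * c1 * sqrt (card S) * lam)" using pos by simp
    also have "\<dots> \<le> \<kappa> * sqrt \<gamma> * r" using r pos by (intro mult_left_mono) auto
    finally show "norm (excess \<beta>0) < \<kappa> * sqrt \<gamma> * r" .
  qed simp
qed

text \<open>The error bound of one step stays within the radius of
  \<open>card_active_outside\<close>, so the cardinality bound is an invariant of the
  iteration.\<close>

lemma step_card_active:
  assumes min: "is_arg_min (\<lambda>\<beta>. Q \<beta> + reweighted_l1 q' lam \<beta>0 \<beta>) (\<lambda>_. True) \<beta>"
    and card: "real (card (active \<beta>0 - S)) \<le> c1\<^sup>2 * card S"
  shows "real (card (active \<beta> - S)) \<le> c1\<^sup>2 * card S"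
proof (rule card_active_outside)
  have "\<kappa> * \<gamma> * norm (\<beta> - bo) \<le> lam * sqrt (card S) * sqrt (1 + (a * c1 / 2)\<^sup>2)"
    using reweighting_step[OF assms] norm_excess_le[OF card] by linarith
  also have "\<dots> \<le> lam * sqrt (card S) * (\<alpha>0 * \<kappa> * \<gamma> * c1)"
    using sqrt_less_c1 pos by (intro mult_left_mono) auto
  also have "\<dots> = \<kappa> * \<gamma> * (\<alpha>0 * c1 * sqrt (card S) * lam)" by simp
  finally show "norm (\<beta> - bo) \<le> \<alpha>0 * c1 * sqrt (card S) * lam" using pos by simp
qed

section \<open>Convergence of the iterates\<close>

text \<open>At 0 every weight is \<open>lam\<close>, which is at least \<open>a * lam\<close>; the
  invariant therefore holds trivially at the start.\<close>

lemma active_0: "active 0 = S"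
  using a_le_1 pos by (auto simp: active_def scaled_penalty_deriv_def q'_0)

lemma norm_excess_0: "norm (excess 0) = lam * sqrt (card S)"
proof (rule power2_eq_imp_eq)
  show "(norm (excess 0))\<^sup>2 = (lam * sqrt (card S))\<^sup>2"
    by (simp add: norm_excess_sq active_0 scaled_penalty_deriv_def q'_0 power_mult_distrib)
qed (use pos in auto)

text \<open>The first step starts from an excess of norm \<open>lam * sqrt (card S)\<close> and
  brings no factor \<open>\<delta>\<close>; each later one does. The cardinality invariant is
  carried along in the induction.\<close>

lemma iterate_error:
  assumes b: "is_iterate_sequence Q q' lam b"
  shows "\<kappa> * \<gamma> * norm (b (Suc k) - bo) \<le> \<delta> ^ k * (lam * sqrt (card S)) \<and>
    real (card (active (b (Suc k)) - S)) \<le> c1\<^sup>2 * card S"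
proof (induction k)
  case 0
  have "b 0 = 0"
    and min: "is_arg_min (\<lambda>\<beta>. Q \<beta> + reweighted_l1 q' lam (b 0) \<beta>) (\<lambda>_. True) (b (Suc 0))"
    using b by (auto simp: is_iterate_sequence_def)
  moreover have "real (card (active 0 - S)) \<le> c1\<^sup>2 * card S" by (simp add: active_0)
  ultimately show ?case
    using reweighting_step[of 0] step_card_active[of 0] by (simp add: norm_excess_0)
next
  case (Suc k)
  have min: "is_arg_min (\<lambda>\<beta>. Q \<beta> + reweighted_l1 q' lam (b (Suc k)) \<beta>) (\<lambda>_. True) (b (Suc (Suc k)))"
    using b by (auto simp: is_iterate_sequence_def)
  \<comment> \<open>The step bounds the new error by the excess, and \<open>excess_le_error\<close>
    bounds the excess by the old error.\<close>
  have "\<kappa> * \<gamma> * norm (b (Suc (Suc k)) - bo) \<le> \<delta> * (\<kappa> * \<gamma> * norm (b (Suc k) - bo))"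
    using reweighting_step[OF min] excess_le_error[of "b (Suc k)"] Suc by (simp add: mult.assoc)
  also have "\<dots> \<le> \<delta> * (\<delta> ^ k * (lam * sqrt (card S)))"
    using Suc pos by (intro mult_left_mono) auto
  finally show ?case using step_card_active[OF min] Suc by (simp add: mult.assoc)
qed

text \<open>The iterate \<open>b (Suc k)\<close> is so close to \<open>bo\<close> that its excess is
  zero; one further step is then exact.\<close>

lemma iterate_eq_oracle:
  assumes b: "is_iterate_sequence Q q' lam b" and k: "\<delta> ^ Suc k * sqrt (card S) \<le> 1"
  shows "b (Suc (Suc k)) = bo"
proof -
  have min: "is_arg_min (\<lambda>\<beta>. Q \<beta> + reweighted_l1 q' lam (b (Suc k)) \<beta>) (\<lambda>_. True) (b (Suc (Suc k)))"
    using b by (auto simp: is_iterate_sequence_def)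
  have "\<delta> * \<kappa> * \<gamma> * norm (b (Suc k) - bo) \<le> \<delta> * (\<delta> ^ k * (lam * sqrt (card S)))"
    using iterate_error[OF b, of k] pos by (simp add: mult.assoc)
  also have "\<dots> = lam * (\<delta> ^ Suc k * sqrt (card S))" by simp
  also have "\<dots> \<le> lam" using k pos by (simp add: mult_le_cancel_left1 del: power_Suc)
  finally have "norm (b (Suc k) - bo) \<le> \<theta> * lam" using pos by (simp add: field_simps)
  then have "\<kappa> * \<gamma> * norm (b (Suc (Suc k)) - bo) \<le> 0"
    using reweighting_step[OF min] iterate_error[OF b, of k] excess_eq_0 by simp
  then show ?thesis using pos by (simp add: mult_le_0_iff)
qed

text \<open>All \<open>k\<close> are covered, including 0, so for empty \<open>S\<close> the theorem
  does not depend on the value of \<open>ln 0\<close>.\<close>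

lemma iterate_eq_oracle_empty:
  assumes b: "is_iterate_sequence Q q' lam b" and S: "S = {}"
  shows "b k = bo"
proof (cases k)
  case 0
  then show ?thesis using b S bo_outside by (simp add: is_iterate_sequence_def vec_eq_iff)
next
  case (Suc m)
  have "\<kappa> * \<gamma> * norm (b k - bo) \<le> 0" using iterate_error[OF b, of m] S Suc by simp
  then show ?thesis using pos by (simp add: mult_le_0_iff)
qed

end

section \<open>From the logarithmic threshold to the strong oracle property\<close>

text \<open>Dividing \<open>c\<close> by \<open>\<delta>\<close> inside the logarithm adds exactly
  one to the quotient, hence the exponent \<open>k\<close> under a bound on
  \<open>Suc k\<close>.\<close>

lemma geometric_decay_after_log_steps:
  fixes \<delta> c :: real
  assumes \<delta>: "0 < \<delta>" "\<delta> < 1" and c: "0 < c" and k: "\<lceil>ln (c / \<delta>) / ln (1 / \<delta>)\<rceil> \<le> int (Suc k)"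
  shows "\<delta> ^ k * c \<le> 1"
proof -
  have L: "0 < ln (1 / \<delta>)" using \<delta> by simp
  have "ln (c / \<delta>) / ln (1 / \<delta>) \<le> real (Suc k)" using k by (simp add: ceiling_le_iff)
  then have "ln (c / \<delta>) \<le> real (Suc k) * ln (1 / \<delta>)" using L by (simp add: field_simps)
  then have "ln c + real k * ln \<delta> \<le> 0" using \<delta> c by (simp add: ln_div algebra_simps)
  then have "ln (\<delta> ^ k * c) \<le> 0" using \<delta> c by (simp add: ln_mult ln_realpow)
  then show ?thesis using \<delta> c by (simp add: ln_le_zero_iff)
qed

text \<open>Conditioning is read pointwise on the event, for arbitrary choices of minimizers. For
  \<open>s = 1\<close> the ceiling equals 1, but the first iterate carries weight \<open>lam\<close>
  on \<open>S\<close> and cannot equal a nonzero oracle estimator; hence the clause asking for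
  \<open>2 \<le> k\<close> in that case, which the English statement lacks.\<close>

theorem theorem4p4:
  fixes M :: "'w measure"
    and \<tau> h lam \<delta> \<kappa> \<alpha>0 \<alpha>1 r l c1 \<gamma> :: real
    and x :: "'w \<Rightarrow> real ^ 'p" and y \<epsilon> :: "'w \<Rightarrow> real"
    and j1 :: 'p and \<beta>star :: "real ^ 'p"
    and n :: nat and X :: "nat \<Rightarrow> 'w \<Rightarrow> real ^ 'p" and Y :: "nat \<Rightarrow> 'w \<Rightarrow> real"
    and K q q' :: "real \<Rightarrow> real"
    and R :: "real ^ 'p ^ 'p"
    and bora :: "'w \<Rightarrow> real ^ 'p" and b :: "nat \<Rightarrow> 'w \<Rightarrow> real ^ 'p"
  defines "S \<equiv> supp \<beta>star"
    and "s \<equiv> card (supp \<beta>star)"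
    and "Q \<equiv> Qhat \<tau> K h n X Y"
    and "gradQ \<equiv> grad_Qhat \<tau> K h n X Y"
  assumes model: "quantile_regression M \<tau> x y \<epsilon> j1 \<beta>star n X Y"
    and gamma: "is_smallest_eigenvalue (second_moment M x) \<gamma>" "0 < \<gamma>" "\<gamma> \<le> 1"
    and sqrt_Sigma: "is_psd_sqrt R (second_moment M x)"
    and kernel: "smoothing_kernel K"
    and bandwidth: "0 < h"
    and penalty: "concave_penalty q q'"
    and lam_pos: "0 < lam"
    and delta: "0 < \<delta>" "\<delta> < 1"
    and kappa: "0 < \<kappa>"
    and alpha: "0 < \<alpha>0" "\<alpha>0 < \<alpha>1"
    and alpha0: "0 < q' \<alpha>0" "1 / (\<delta> * \<kappa> * \<gamma>) < \<alpha>0 / sqrt (1 + (q' \<alpha>0 / 2)\<^sup>2)"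
    and alpha1: "q' \<alpha>1 = 0"
    and c1: "0 < c1" "0.5 * q' \<alpha>0 * sqrt (c1\<^sup>2 + 1) + 1 = \<alpha>0 * \<kappa> * \<gamma> * c1"
    and r: "sqrt \<gamma> * \<alpha>0 * c1 * sqrt (real s) * lam \<le> r"
    and l: "l = (2 + 2 / q' \<alpha>0) * sqrt (c1\<^sup>2 + 1) * sqrt (real s / \<gamma>)"
    and beta_min: "\<forall>j\<in>S. (\<alpha>0 + \<alpha>1) * lam \<le> \<bar>\<beta>star $ j\<bar>"
    and ora: "\<forall>\<omega>\<in>space M. is_oracle_estimator (Q \<omega>) S (bora \<omega>)"
    and iterates: "\<forall>\<omega>\<in>space M. is_iterate_sequence (Q \<omega>) q' lam (\<lambda>k. b k \<omega>)"
  shows "\<forall>\<omega> \<in> {\<omega>\<in>space M. infnorm (gradQ \<omega> (bora \<omega>)) \<le> 0.5 * q' \<alpha>0 * lam}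
            \<inter> {\<omega>\<in>space M. wnorm R (bora \<omega> - \<beta>star) \<le> r / 2}
            \<inter> rsc_event M gradQ R \<beta>star r l \<kappa>
            \<inter> {\<omega>\<in>space M. infnorm (bora \<omega> - \<beta>star)
                  \<le> (\<alpha>0 - sqrt (1 + (q' \<alpha>0 / 2)\<^sup>2) / (\<delta> * \<kappa> * \<gamma>)) * lam}.
          \<forall>k::nat. \<lceil>ln (sqrt (real s) / \<delta>) / ln (1 / \<delta>)\<rceil> \<le> int k \<and> (s = 1 \<longrightarrow> 2 \<le> k)
            \<longrightarrow> b k \<omega> = bora \<omega>"
proof (intro ballI allI impI)
  fix \<omega> k
  assume ev: "\<omega> \<in> {\<omega>\<in>space M. infnorm (gradQ \<omega> (bora \<omega>)) \<le> 0.5 * q' \<alpha>0 * lam}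
            \<inter> {\<omega>\<in>space M. wnorm R (bora \<omega> - \<beta>star) \<le> r / 2}
            \<inter> rsc_event M gradQ R \<beta>star r l \<kappa>
            \<inter> {\<omega>\<in>space M. infnorm (bora \<omega> - \<beta>star)
                  \<le> (\<alpha>0 - sqrt (1 + (q' \<alpha>0 / 2)\<^sup>2) / (\<delta> * \<kappa> * \<gamma>)) * lam}"
    and k: "\<lceil>ln (sqrt (real s) / \<delta>) / ln (1 / \<delta>)\<rceil> \<le> int k \<and> (s = 1 \<longrightarrow> 2 \<le> k)"
  then have \<omega>: "\<omega> \<in> space M" by blast
  have tau: "0 < \<tau>" "\<tau> < 1"
    using quantile_regression.tau[OF model] by auto
  have dkg: "0 < \<delta> * \<kappa> * \<gamma>" using delta kappa gamma by simp
  have root: "1 \<le> sqrt (1 + (q' \<alpha>0 / 2)\<^sup>2)" by simp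
  have pen: "0 \<le> q' t \<and> q' t \<le> 1" if "0 \<le> t" for t
    using penalty that by (auto simp: concave_penalty_def)
  have bo_supp: "supp (bora \<omega>) \<subseteq> supp \<beta>star"
    using ora \<omega> by (auto simp: is_oracle_estimator_def is_arg_min_def S_def supp_def)
  \<comment> \<open>The root is at least 1, so the error bound of the event implies the form asked
    for by \<open>ora_error\<close>.\<close>
  have theta: "1 / (\<delta> * \<kappa> * \<gamma>) \<le> sqrt (1 + (q' \<alpha>0 / 2)\<^sup>2) / (\<delta> * \<kappa> * \<gamma>)"
    using root dkg by (intro divide_right_mono) auto
  interpret oracle_reweighting "Q \<omega>" "gradQ \<omega>" "wnorm R" q' S "bora \<omega>" \<beta>star
    lam \<delta> \<kappa> \<alpha>0 \<alpha>1 r l c1 \<gamma>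
  proof
    show "GDERIV (Q \<omega>) \<beta> :> gradQ \<omega> \<beta>" for \<beta>
      unfolding Q_def gradQ_def by (rule GDERIV_Qhat[OF kernel bandwidth tau])
    show "0 \<le> (gradQ \<omega> \<beta>1 - gradQ \<omega> \<beta>2) \<bullet> (\<beta>1 - \<beta>2)" for \<beta>1 \<beta>2
      unfolding gradQ_def by (rule grad_Qhat_monotone[OF kernel bandwidth])
    show "sqrt \<gamma> * norm v \<le> wnorm R v" for v
      using wnorm_ge[OF sqrt_Sigma gamma(1)] gamma(2) by simp
    \<comment> \<open>The event is used with \<open>\<beta>2\<close> the oracle estimator,
      admissible by its support and its distance at most \<open>r / 2\<close> from
      \<open>\<beta>star\<close>.\<close>
    show "\<kappa> * (wnorm R (\<beta> - bora \<omega>))\<^sup>2 \<le> (gradQ \<omega> \<beta> - gradQ \<omega> (bora \<omega>)) \<bullet> (\<beta> - bora \<omega>)"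
      if "wnorm R (\<beta> - bora \<omega>) \<le> r" "l1norm (\<beta> - bora \<omega>) \<le> l * wnorm R (\<beta> - bora \<omega>)" for \<beta>
      using ev that bo_supp by (auto simp: rsc_event_def)
    show "\<bar>gradQ \<omega> (bora \<omega>) $ j\<bar> \<le> q' \<alpha>0 * lam / 2" for j
      using ev component_le_infnorm_cart[of "gradQ \<omega> (bora \<omega>)" j] by simp
    show "\<bar>bora \<omega> $ j - \<beta>star $ j\<bar> \<le> (\<alpha>0 - 1 / (\<delta> * \<kappa> * \<gamma>)) * lam" for j
    proof -
      have "\<bar>bora \<omega> $ j - \<beta>star $ j\<bar> \<le>
          (\<alpha>0 - sqrt (1 + (q' \<alpha>0 / 2)\<^sup>2) / (\<delta> * \<kappa> * \<gamma>)) * lam"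
        using ev component_le_infnorm_cart[of "bora \<omega> - \<beta>star" j] by simp
      also have "\<dots> \<le> (\<alpha>0 - 1 / (\<delta> * \<kappa> * \<gamma>)) * lam"
        using theta lam_pos by (intro mult_right_mono) auto
      finally show ?thesis .
    qed
    show "1 / (\<delta> * \<kappa> * \<gamma>) < \<alpha>0"
    proof -
      have "\<alpha>0 / sqrt (1 + (q' \<alpha>0 / 2)\<^sup>2) \<le> \<alpha>0 / 1"
        using root alpha by (intro divide_left_mono) (auto simp: add_pos_nonneg)
      with alpha0(2) show ?thesis by simp
    qed
    show "q' t1 \<le> q' t2" if "0 \<le> t2" "t2 \<le> t1" for t1 t2
      using penalty that by (auto simp: concave_penalty_def)
    show "q' 0 = 1" using penalty by (auto simp: concave_penalty_def)
    show "sqrt \<gamma> * \<alpha>0 * c1 * sqrt (card S) * lam \<le> r" using r by (simp add: s_def S_def)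
    show "l = (2 + 2 / q' \<alpha>0) * sqrt (c1\<^sup>2 + 1) * sqrt (card S / \<gamma>)"
      using l by (simp add: s_def S_def)
    show "q' \<alpha>0 / 2 * sqrt (c1\<^sup>2 + 1) + 1 = \<alpha>0 * \<kappa> * \<gamma> * c1" using c1(2) by simp
  qed (use \<omega> ora beta_min pen lam_pos delta kappa gamma alpha alpha0 alpha1 c1 in
      \<open>auto simp: wnorm_scaleR\<close>)
  have b: "is_iterate_sequence (Q \<omega>) q' lam (\<lambda>k. b k \<omega>)" using iterates \<omega> by blast
  have s: "s = card S" by (simp add: s_def S_def)
  show "b k \<omega> = bora \<omega>"
  proof (cases "S = {}")
    case True
    then show ?thesis by (rule iterate_eq_oracle_empty[OF b])
  next
    case False
    then have "0 < s" by (simp add: s card_gt_0_iff)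
    \<comment> \<open>For \<open>k \<le> 1\<close> the threshold would force
      \<open>sqrt s \<le> 1\<close>, so \<open>s = 1\<close>, which the extra clause on
      \<open>k\<close> excludes.\<close>
    have "2 \<le> k"
    proof (rule ccontr)
      assume "\<not> 2 \<le> k"
      then have "\<lceil>ln (sqrt (real s) / \<delta>) / ln (1 / \<delta>)\<rceil> \<le> int (Suc 0)" using k by linarith
      then have "\<delta> ^ 0 * sqrt (real s) \<le> 1"
        using \<open>0 < s\<close> by (intro geometric_decay_after_log_steps[OF delta]) auto
      with \<open>\<not> 2 \<le> k\<close> k \<open>0 < s\<close> show False by simp
    qed
    then obtain m where m: "k = Suc (Suc m)" by (metis add_2_eq_Suc le_Suc_ex)
    have "\<delta> ^ Suc m * sqrt (real s) \<le> 1"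
      using k m \<open>0 < s\<close> by (intro geometric_decay_after_log_steps[OF delta]) auto
    then show ?thesis unfolding m s by (rule iterate_eq_oracle[OF b])
  qed
qed

end
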